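(* Up to isomorphism, the only simple algebras in the variety $\mathbf{I}$ of implication zroupoids are the five algebras $\mathbf{2_z}$, $\mathbf{2_s}$, $\mathbf{2_b}$, $\mathbf{3}_k$ and $\mathbf{4}_d$ (each of these five algebras is simple and belongs to $\mathbf{I}$, and every simple algebra in $\mathbf{I}$ is isomorphic to one of them).
   Context: An implication zroupoid is an algebra $\mathbf{A} = \langle A, \to, 0\rangle$, with $\to$ binary and $0$ a constant, satisfying, with the abbreviation $x' := x \to 0$ (so $x'' = (x\to 0)\to 0$), the identities (I) $(x \to y) \to z \approx [(z' \to x) \to (y \to z)']'$ and (I$_0$) $0'' \approx 0$. The variety of all implication zroupoids is denoted $\mathbf{I}$. An algebra is simple if it has more than one element and its only congruences are the identity relation $\Delta$ and $A \times A$. The five algebras are given by the following tables (constant $0$ is the element $0$; the row is the left argument of $\to$). $\mathbf{2_z}$ on $\{0,1\}$: $x \to y = 0$ for all $x,y$. $\mathbf{2_s}$ on $\{0,1\}$: $0\to 0 = 0$, $0 \to 1 = 1\to 0 = 1 \to 1 = 1$. $\mathbf{2_b}$ on $\{0,1\}$: $0\to 0 = 0\to 1 = 1 \to 1 = 1$, $1 \to 0 = 0$. $\mathbf{3}_k$ on $\{0,1,2\}$: row $0$ is $(0\to 0, 0\to 1, 0\to 2) = (1,1,1)$; row $1$ is $(0,1,2)$; row $2$ is $(2,1,2)$. $\mathbf{4}_d$ on $\{0,1,2,3\}$: row $0$ is $(1,1,1,1)$; row $1$ is $(0,1,2,3)$; row $2$ is $(2,1,2,1)$; row $3$ is $(3,1,1,3)$,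 where row $i$ lists $(i\to 0, i \to 1, i\to 2, i\to 3)$. *)

theory Defs
  imports Main
begin

text \<open>Algebras of type (2, 0), given by an explicit carrier set. Outside the carrier the
  operation is unconstrained, so all notions below are relativised to the carrier.\<close>

record 'a zalgebra =
  carrier :: "'a set"
  imp :: "'a \<Rightarrow> 'a \<Rightarrow> 'a"  (infixr "\<rightarrow>\<index>" 65)
  zero :: 'a  ("\<zero>\<index>")

definition zprime :: "'a zalgebra \<Rightarrow> 'a \<Rightarrow> 'a" where
  "zprime A x = (x \<rightarrow>\<^bsub>A\<^esub> \<zero>\<^bsub>A\<^esub>)"

definition is_algebra :: "'a zalgebra \<Rightarrow> bool" where
  "is_algebra A \<longleftrightarrow>
     \<zero>\<^bsub>A\<^esub> \<in> carrier A \<and>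
     (\<forall>x\<in>carrier A. \<forall>y\<in>carrier A. (x \<rightarrow>\<^bsub>A\<^esub> y) \<in> carrier A)"

definition implication_zroupoid :: "'a zalgebra \<Rightarrow> bool" where
  "implication_zroupoid A \<longleftrightarrow>
     is_algebra A \<and>
     (\<forall>x\<in>carrier A. \<forall>y\<in>carrier A. \<forall>z\<in>carrier A.
        ((x \<rightarrow>\<^bsub>A\<^esub> y) \<rightarrow>\<^bsub>A\<^esub> z) =
        zprime A ((zprime A z \<rightarrow>\<^bsub>A\<^esub> x) \<rightarrow>\<^bsub>A\<^esub> zprime A (y \<rightarrow>\<^bsub>A\<^esub> z))) \<and>
     zprime A (zprime A \<zero>\<^bsub>A\<^esub>) = \<zero>\<^bsub>A\<^esub>"

definition congruence :: "'a zalgebra \<Rightarrow> ('a \<times> 'a) set \<Rightarrow> bool" where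
  "congruence A \<theta> \<longleftrightarrow>
     equiv (carrier A) \<theta> \<and>
     (\<forall>x y u v. (x, y) \<in> \<theta> \<longrightarrow> (u, v) \<in> \<theta> \<longrightarrow> (x \<rightarrow>\<^bsub>A\<^esub> u, y \<rightarrow>\<^bsub>A\<^esub> v) \<in> \<theta>)"

definition simple_algebra :: "'a zalgebra \<Rightarrow> bool" where
  "simple_algebra A \<longleftrightarrow>
     (\<exists>x\<in>carrier A. \<exists>y\<in>carrier A. x \<noteq> y) \<and>
     (\<forall>\<theta>. congruence A \<theta> \<longrightarrow> \<theta> = Id_on (carrier A) \<or> \<theta> = carrier A \<times> carrier A)"

definition isomorphic :: "'a zalgebra \<Rightarrow> 'b zalgebra \<Rightarrow> bool" where
  "isomorphic A B \<longleftrightarrow>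
     (\<exists>h. bij_betw h (carrier A) (carrier B) \<and>
          (\<forall>x\<in>carrier A. \<forall>y\<in>carrier A. h (x \<rightarrow>\<^bsub>A\<^esub> y) = (h x \<rightarrow>\<^bsub>B\<^esub> h y)) \<and>
          h \<zero>\<^bsub>A\<^esub> = \<zero>\<^bsub>B\<^esub>)"

text \<open>The row of a table is the left argument of the operation.\<close>

definition table_algebra :: "nat list list \<Rightarrow> nat zalgebra" where
  "table_algebra t = \<lparr>carrier = {..<length t}, imp = (\<lambda>i j. t ! i ! j), zero = 0\<rparr>"

definition two_z :: "nat zalgebra" where
  "two_z = table_algebra
     [[0, 0],
      [0, 0]]"

definition two_s :: "nat zalgebra" where
  "two_s = table_algebra
     [[0, 1],
      [1, 1]]"

definition two_b :: "nat zalgebra" where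
  "two_b = table_algebra
     [[1, 1],
      [0, 1]]"

definition three_k :: "nat zalgebra" where
  "three_k = table_algebra
     [[1, 1, 1],
      [0, 1, 2],
      [2, 1, 2]]"

definition four_d :: "nat zalgebra" where
  "four_d = table_algebra
     [[1, 1, 1, 1],
      [0, 1, 2, 3],
      [2, 1, 2, 1],
      [3, 1, 1, 3]]"

end

theory Submission
  imports Defs
begin

text \<open>In a simple algebra the kernel of every map that is compatible with the operation is either
  trivial or total. The classification reads this dichotomy off five well-chosen kernels; write
  \<open>\<sim> x\<close> for \<open>x \<rightarrow> 0\<close> and \<open>\<top>\<close> for \<open>\<sim> 0\<close>.

  The map \<open>x \<mapsto> \<sim> \<sim> x\<close> is always an idempotent endomorphism (\<open>neg_neg_imp\<close>, \<open>neg4\<close>). If its kernel is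
  total, then every product annihilates from the left, collapsing all products to \<open>0\<close> is
  another congruence, and the operation turns out to be constant: this gives \<open>two_z\<close>. Otherwise
  \<open>\<sim> \<sim> x = x\<close> holds.

  With an involutive negation, the map \<open>x \<mapsto> 0 \<rightarrow> x\<close> is idempotent and its kernel is again
  a congruence (\<open>bot_imp_imp_cong\<close>). If it is injective, then \<open>\<top> = 0\<close>, so \<open>x \<rightarrow> y\<close> vanishes
  only if \<open>x\<close> and \<open>y\<close> do, and \<open>{0}\<close> together with its complement are the classes of a congruence:
  this gives \<open>two_s\<close>. If it is constant, then \<open>0 \<rightarrow> x = \<top>\<close>, and \<open>\<sim> x \<rightarrow> y\<close> is the join of a
  De Morgan algebra with least element \<open>0\<close>.

  In a De Morgan algebra each element \<open>b\<close> yields the congruence identifying elements with the same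
  values of \<open>x \<rightarrow> b\<close> and \<open>\<sim> x \<rightarrow> b\<close>. It identifies \<open>\<sim> b\<close> with \<open>b \<rightarrow> b\<close>, and it is total only
  for \<open>b = \<top>\<close>. Hence a simple one satisfies \<open>\<sim> b = b \<rightarrow> b\<close> for \<open>b \<noteq> \<top>\<close>, and applying this also
  to \<open>\<sim> b\<close> shows that every element other than \<open>0\<close> and \<open>\<top>\<close> is a fixed point of the negation. Two
  distinct fixed points are complements of each other, and by distributivity an element has at most
  one complement; so there are at most two fixed points. The cases of none, one and two are \<open>two_b\<close>,
  \<open>three_k\<close> and \<open>four_d\<close>.\<close>

section \<open>Total implication zroupoids\<close>

text \<open>The identities are first studied for an operation on a whole type, so that they can be used as
  rewrite rules without membership conditions.\<close>

locale zroupoid =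
  fixes imp :: "'a \<Rightarrow> 'a \<Rightarrow> 'a"  (infixr "\<rhd>" 65)
    and bot :: 'a  ("\<bottom>")
  assumes imp_imp: "(x \<rhd> y) \<rhd> z = ((((z \<rhd> \<bottom>) \<rhd> x) \<rhd> ((y \<rhd> z) \<rhd> \<bottom>)) \<rhd> \<bottom>)"
    and neg_neg_bot: "(\<bottom> \<rhd> \<bottom>) \<rhd> \<bottom> = \<bottom>"
begin

abbreviation neg :: "'a \<Rightarrow> 'a"  ("\<sim> _" [80] 80)
  where "\<sim> x \<equiv> x \<rhd> \<bottom>"

abbreviation top :: 'a  ("\<top>")
  where "\<top> \<equiv> \<sim> \<bottom>"

text \<open>The next lemmas show that \<open>\<top>\<close> can be erased in front of a variable in more and more
  contexts. The aim is \<open>top_imp\<close>: the left multiplication by \<open>\<top>\<close> is the double negation, which is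
  what turns instances of the defining identity into statements about double negations.\<close>

lemma neg_neg_top_imp: "\<sim> \<sim> (\<top> \<rhd> x) = \<sim> \<sim> x"
  using imp_imp[of x \<bottom> \<bottom>] by (simp add: neg_neg_bot)

lemma neg_imp_top_imp: "\<sim> (x \<rhd> (\<top> \<rhd> y)) = \<sim> (x \<rhd> y)"
  using imp_imp[of x y \<bottom>] imp_imp[of x "\<top> \<rhd> y" \<bottom>] by (simp add: neg_neg_top_imp)

lemma bot_imp_imp_top_imp: "(\<bottom> \<rhd> x) \<rhd> (\<top> \<rhd> y) = (\<bottom> \<rhd> x) \<rhd> y"
  using imp_imp[of \<bottom> x y] imp_imp[of \<bottom> x "\<top> \<rhd> y"]
  by (simp add: neg_neg_top_imp neg_imp_top_imp)

lemma neg_top_imp_imp: "\<sim> ((\<top> \<rhd> x) \<rhd> y) = \<sim> (x \<rhd> y)"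
proof -
  have "\<top> \<rhd> (\<top> \<rhd> x) = \<top> \<rhd> x"
    by (rule bot_imp_imp_top_imp)
  then show ?thesis
    using imp_imp[of x y \<bottom>] imp_imp[of "\<top> \<rhd> x" y \<bottom>] by simp
qed

lemma neg_imp_neg_neg: "\<sim> (x \<rhd> \<sim> \<sim> y) = \<sim> (x \<rhd> y)"
  using imp_imp[of x y \<bottom>] neg_top_imp_imp[of x "\<sim> \<sim> y"] by simp

lemma neg4: "\<sim> \<sim> \<sim> \<sim> x = \<sim> \<sim> x"
  by (metis neg_neg_top_imp neg_imp_neg_neg)

text \<open>By the defining identity a nested product is a negation \<open>\<sim> w\<close>, and \<open>w\<close> is again a nested
  product. The law \<open>\<sim> \<sim> \<sim> \<sim> x = \<sim> \<sim> x\<close>, applied first to \<open>w\<close> and then one level deeper, therefore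
  cancels a double negation.\<close>

lemma neg_neg_imp_imp: "\<sim> \<sim> ((x \<rhd> y) \<rhd> z) = (x \<rhd> y) \<rhd> z"
proof -
  have neg3: "\<sim> \<sim> \<sim> ((x \<rhd> y) \<rhd> z) = \<sim> ((x \<rhd> y) \<rhd> z)" for x y z
    by (metis imp_imp neg4)
  show ?thesis
    using imp_imp[of x y z] neg3[of "\<sim> z" x "\<sim> (y \<rhd> z)"] by metis
qed

lemma top_imp: "\<top> \<rhd> x = \<sim> \<sim> x"
  using neg_neg_imp_imp[of \<bottom> \<bottom> x] neg_neg_top_imp[of x] by simp

lemma neg_imp_imp: "\<sim> ((x \<rhd> y) \<rhd> z) = (\<sim> z \<rhd> x) \<rhd> \<sim> (y \<rhd> z)"
  using imp_imp[of x y z] neg_neg_imp_imp[of "\<sim> z" x "\<sim> (y \<rhd> z)"] by simp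

lemma neg_neg_imp: "\<sim> \<sim> (x \<rhd> y) = \<sim> \<sim> x \<rhd> \<sim> \<sim> y"
  using neg_imp_imp[of x y \<bottom>] by (simp add: top_imp)

end


section \<open>Implication zroupoids with an involutive negation\<close>

text \<open>An algebra whose negation is an involution on its carrier is later extended to the whole type by
  mapping foreign elements into the carrier. The extended operation does not satisfy
  \<open>\<sim> \<sim> x = x\<close>, but double negations of arguments, and of products, remain irrelevant. Hence the
  form of the axioms; an equation with a variable on one side has its double negation there.\<close>

locale involutive_zroupoid = zroupoid +
  assumes neg_neg_left [simp]: "\<sim> \<sim> x \<rhd> y = x \<rhd> y"
    and neg_neg_right [simp]: "x \<rhd> \<sim> \<sim> y = x \<rhd> y"
begin

lemma neg_neg_prod [simp]: "\<sim> \<sim> (x \<rhd> y) = x \<rhd> y"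
  by (simp add: neg_neg_imp)

lemma neg_neg_bot' [simp]: "\<sim> \<top> = \<bottom>"
  by (rule neg_neg_bot)

lemma top_imp_prod [simp]: "\<top> \<rhd> (x \<rhd> y) = x \<rhd> y"
  by (simp add: top_imp)

text \<open>Several of the laws below would loop as rewrite rules, since \<open>\<sim>\<close> and \<open>\<top>\<close> are themselves instances
  of the operation; they are therefore used through explicit instances.\<close>

lemma bot_imp_imp: "(\<bottom> \<rhd> x) \<rhd> y = \<sim> (y \<rhd> \<sim> (x \<rhd> y))"
  using imp_imp[of \<bottom> x y] by simp

lemma bot_imp_imp_top: "(\<bottom> \<rhd> x) \<rhd> \<top> = x \<rhd> \<top>"
  using bot_imp_imp[of x "\<top>"] by simp

lemma bot_imp_top: "\<bottom> \<rhd> \<top> = \<top>"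
  using bot_imp_imp_top[of \<bottom>] by simp

lemma imp_neg_self: "x \<rhd> \<sim> x = \<sim> x"
proof -
  have "(\<bottom> \<rhd> \<top>) \<rhd> x = \<sim> (x \<rhd> \<sim> (\<top> \<rhd> x))"
    by (rule bot_imp_imp)
  then have "\<sim> \<sim> x = \<sim> (x \<rhd> \<sim> x)"
    by (simp add: bot_imp_top top_imp)
  then show ?thesis
    by (metis neg_neg_prod)
qed

lemma neg_imp_self: "\<sim> x \<rhd> x = \<sim> \<sim> x"
  using imp_neg_self[of "\<sim> x"] by simp

lemma imp_imp_self: "(y \<rhd> x) \<rhd> y = (\<bottom> \<rhd> x) \<rhd> y"
  using imp_imp[of y x y] bot_imp_imp[of x y] by (simp add: neg_imp_self)

lemma neg_imp_top: "\<sim> x \<rhd> \<top> = \<bottom> \<rhd> x"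
  using imp_imp[of x \<bottom> \<top>] by (simp add: bot_imp_top)

lemma imp_top: "x \<rhd> \<top> = \<bottom> \<rhd> \<sim> x"
  using neg_imp_top[of "\<sim> x"] by simp

lemma bot_imp_neg_bot_imp: "\<bottom> \<rhd> \<sim> (\<bottom> \<rhd> x) = \<bottom> \<rhd> \<sim> x"
  using bot_imp_imp_top[of x] by (simp add: imp_top)

lemma bot_imp_bot_imp: "\<bottom> \<rhd> (\<bottom> \<rhd> x) = \<bottom> \<rhd> x"
  by (metis bot_imp_neg_bot_imp neg_neg_prod neg_neg_right)

text \<open>The defining identity with \<open>z = \<top>\<close> shows that \<open>x \<mapsto> \<bottom> \<rhd> x\<close> distributes over the meet
  \<open>\<sim> (x \<rhd> \<sim> y)\<close>. As its value at \<open>\<sim> x\<close> is determined by its value at \<open>x\<close>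
  (\<open>bot_imp_neg_bot_imp\<close>), its kernel is a congruence.\<close>

lemma bot_imp_neg_imp: "\<bottom> \<rhd> \<sim> (x \<rhd> y) = \<sim> ((\<bottom> \<rhd> x) \<rhd> \<sim> (\<bottom> \<rhd> \<sim> y))"
  using imp_imp[of x y \<top>] by (simp add: imp_top)

lemma bot_imp_imp_cong:
  assumes "\<bottom> \<rhd> x = \<bottom> \<rhd> u" and "\<bottom> \<rhd> y = \<bottom> \<rhd> v"
  shows "\<bottom> \<rhd> (x \<rhd> y) = \<bottom> \<rhd> (u \<rhd> v)"
proof -
  have "\<bottom> \<rhd> \<sim> y = \<bottom> \<rhd> \<sim> v"
    using assms(2) by (metis bot_imp_neg_bot_imp)
  then have "\<bottom> \<rhd> \<sim> (x \<rhd> y) = \<bottom> \<rhd> \<sim> (u \<rhd> v)"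
    by (simp add: bot_imp_neg_imp assms(1))
  then show ?thesis
    by (metis bot_imp_neg_bot_imp neg_neg_prod)
qed

text \<open>If \<open>\<top> = \<bottom>\<close>, the element \<open>\<bottom>\<close> is neutral on the left, so that \<open>x \<rhd> y\<close> is the meet of \<open>y\<close> and
  \<open>x \<rhd> y\<close>; if the latter is \<open>\<bottom>\<close>, so is \<open>y\<close>, and then \<open>x\<close>.\<close>

lemma imp_eq_botD:
  assumes "\<top> = \<bottom>" and "x \<rhd> y = \<bottom>"
  shows "\<sim> \<sim> x = \<bottom> \<and> \<sim> \<sim> y = \<bottom>"
proof -
  have "\<bottom> \<rhd> x = \<sim> \<sim> x"
    using top_imp[of x] assms(1) by simp
  then have "x \<rhd> y = \<sim> (y \<rhd> \<sim> (x \<rhd> y))"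
    using bot_imp_imp[of x y] by simp
  then have y: "\<sim> \<sim> y = \<bottom>"
    using assms by simp
  then have "\<sim> \<sim> x = \<bottom>"
    using assms neg_neg_right[of x y] by (metis neg_neg_bot)
  with y show ?thesis by simp
qed

end


section \<open>De Morgan algebras\<close>

text \<open>The operation is the implication \<open>\<sim> x \<squnion> y\<close> of a De Morgan algebra: join and meet are
  commutative, absorptive, distributive and, as a consequence, associative.\<close>

locale de_morgan_zroupoid = involutive_zroupoid +
  assumes bot_imp: "\<bottom> \<rhd> x = \<top>"
begin

lemma absorb: "(x \<rhd> y) \<rhd> x = \<sim> \<sim> x"
  using bot_imp[of y] by (simp add: imp_imp_self top_imp)

lemma neg_imp_commute: "\<sim> x \<rhd> y = \<sim> y \<rhd> x"
proof -
  have "\<sim> (\<sim> x \<rhd> y) = \<sim> (\<sim> y \<rhd> x)"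
    using neg_imp_imp[of x \<bottom> y] bot_imp[of y] by simp
  then show ?thesis
    by (metis neg_neg_prod)
qed

lemma contrapos: "x \<rhd> y = \<sim> y \<rhd> \<sim> x"
  using neg_imp_commute[of "\<sim> x" y] by simp

abbreviation join :: "'a \<Rightarrow> 'a \<Rightarrow> 'a"  (infixl "\<squnion>" 67)
  where "x \<squnion> y \<equiv> \<sim> x \<rhd> y"

abbreviation meet :: "'a \<Rightarrow> 'a \<Rightarrow> 'a"  (infixl "\<sqinter>" 67)
  where "x \<sqinter> y \<equiv> \<sim> (x \<rhd> \<sim> y)"

lemma meet_commute: "x \<sqinter> y = y \<sqinter> x"
  using contrapos[of x "\<sim> y"] by simp

text \<open>This is the defining identity of implication zroupoids, read in terms of joins and meets.\<close>

lemma join_meet_distrib: "x \<sqinter> (y \<squnion> z) = (x \<sqinter> y) \<squnion> (x \<sqinter> z)"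
proof -
  have "\<sim> ((\<sim> y \<rhd> z) \<rhd> \<sim> x) = (x \<rhd> \<sim> y) \<rhd> \<sim> (z \<rhd> \<sim> x)"
    using neg_imp_imp[of "\<sim> y" z "\<sim> x"] by simp
  then show ?thesis
    by (metis meet_commute neg_neg_left neg_neg_prod)
qed

lemma join_meet_self: "x \<squnion> (x \<sqinter> y) = \<sim> \<sim> x"
  using absorb[of x "\<sim> y"] by (simp add: neg_imp_commute[of x])

lemma join_commute: "x \<squnion> y = y \<squnion> x"
  by (rule neg_imp_commute)

text \<open>The equation \<open>x \<sqinter> y = \<sim> \<sim> x\<close> expresses that \<open>x\<close> lies below \<open>y\<close>. Commutativity, absorption and
  distributivity make the join a least upper bound for this relation before associativity is known;
  associativity follows because both bracketings are least upper bounds of the same elements.\<close>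

lemma meet_joinI1: "x \<sqinter> y = \<sim> \<sim> x \<Longrightarrow> x \<sqinter> (y \<squnion> z) = \<sim> \<sim> x"
  using join_meet_distrib[of x y z] join_meet_self[of x z] by simp

lemma meet_joinI2: "x \<sqinter> z = \<sim> \<sim> x \<Longrightarrow> x \<sqinter> (y \<squnion> z) = \<sim> \<sim> x"
  using meet_joinI1[of x z y] by (simp only: join_commute)

lemma meet_self: "x \<sqinter> x = \<sim> \<sim> x"
  by (simp add: imp_neg_self)

lemma join_meetI:
  assumes "x \<sqinter> z = \<sim> \<sim> x" and "y \<sqinter> z = \<sim> \<sim> y"
  shows "(x \<squnion> y) \<sqinter> z = x \<squnion> y"
  using join_meet_distrib[of z x y] assms by (simp only: meet_commute[of z]) simp

lemma join_assoc: "(x \<squnion> y) \<squnion> z = x \<squnion> (y \<squnion> z)"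
proof -
  let ?l = "(x \<squnion> y) \<squnion> z" and ?r = "x \<squnion> (y \<squnion> z)"
  have "?l \<sqinter> ?r = ?l"
    by (simp add: join_meetI meet_joinI1 meet_joinI2 meet_self del: neg_neg_left neg_neg_right)
  moreover have "?r \<sqinter> ?l = ?r"
    by (simp add: join_meetI meet_joinI1 meet_joinI2 meet_self del: neg_neg_left neg_neg_right)
  ultimately show ?thesis
    using meet_commute[of ?l ?r] by metis
qed

lemma neg_imp_exchange: "\<sim> (x \<rhd> y) \<rhd> z = x \<rhd> (\<sim> y \<rhd> z)"
  using join_assoc[of "\<sim> x" y z] by simp

lemma imp_exchange: "x \<rhd> (y \<rhd> z) = y \<rhd> (x \<rhd> z)"
  by (metis neg_imp_exchange contrapos neg_neg_left neg_neg_right)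

text \<open>Up to a double negation, \<open>x \<rhd> b\<close> and \<open>\<sim> x \<rhd> b\<close> are the joins of \<open>b\<close> with \<open>\<sim> x\<close> and with \<open>x\<close>.
  The elements with the same two values form a congruence class: distributivity handles
  \<open>(x \<rhd> y) \<rhd> b\<close> and associativity handles \<open>\<sim> (x \<rhd> y) \<rhd> b\<close>.\<close>

lemma bounded_kernel_cong:
  assumes "x \<rhd> b = u \<rhd> b" and "\<sim> x \<rhd> b = \<sim> u \<rhd> b"
  shows "(x \<rhd> y) \<rhd> b = (u \<rhd> y) \<rhd> b" and "\<sim> (x \<rhd> y) \<rhd> b = \<sim> (u \<rhd> y) \<rhd> b"
    and "(y \<rhd> x) \<rhd> b = (y \<rhd> u) \<rhd> b" and "\<sim> (y \<rhd> x) \<rhd> b = \<sim> (y \<rhd> u) \<rhd> b"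
proof -
  have "\<sim> b \<rhd> x = \<sim> b \<rhd> u"
    using assms(2) by (simp only: neg_imp_commute[of b])
  then show "(x \<rhd> y) \<rhd> b = (u \<rhd> y) \<rhd> b"
    using imp_imp[of x y b] imp_imp[of u y b] by simp
  have "\<sim> (v \<rhd> y) \<rhd> b = \<sim> y \<rhd> (v \<rhd> b)" for v
    using neg_imp_exchange[of v y b] imp_exchange[of v "\<sim> y" b] by simp
  then show "\<sim> (x \<rhd> y) \<rhd> b = \<sim> (u \<rhd> y) \<rhd> b"
    by (simp only: assms)
  show "(y \<rhd> x) \<rhd> b = (y \<rhd> u) \<rhd> b"
    using imp_imp[of y x b] imp_imp[of y u b] assms(1) by simp
  show "\<sim> (y \<rhd> x) \<rhd> b = \<sim> (y \<rhd> u) \<rhd> b"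
    by (simp only: neg_imp_exchange assms)
qed

text \<open>The congruence belonging to \<open>b\<close> identifies \<open>\<sim> b\<close> with \<open>b \<rhd> b\<close>, which is the join of \<open>\<sim> b\<close> and
  \<open>b\<close>. If the congruence is trivial, then \<open>b\<close> lies below \<open>\<sim> b\<close>.\<close>

lemma bounded_kernel_neg:
  shows "\<sim> b \<rhd> b = (b \<rhd> b) \<rhd> b" and "\<sim> \<sim> b \<rhd> b = \<sim> (b \<rhd> b) \<rhd> b"
proof -
  show "\<sim> b \<rhd> b = (b \<rhd> b) \<rhd> b"
    by (simp only: absorb neg_imp_self)
  show "\<sim> \<sim> b \<rhd> b = \<sim> (b \<rhd> b) \<rhd> b"
    using neg_imp_exchange[of b b b] by (simp add: neg_imp_self)
qed

text \<open>For fixed points \<open>b\<close> and \<open>c\<close> of the negation, \<open>b \<rhd> c\<close> is their join and its negation is their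
  meet. If both agree, then so do \<open>b\<close> and \<open>c\<close>.\<close>

lemma fixpoint_imp_eqD:
  assumes "\<sim> b = b" and "\<sim> c = c" and "\<sim> (b \<rhd> c) = b \<rhd> c"
  shows "b = c"
proof -
  have *: "b = b \<rhd> c" if "\<sim> b = b" "\<sim> c = c" "\<sim> (b \<rhd> c) = b \<rhd> c" for b c
  proof -
    have "b = (b \<rhd> c) \<rhd> b"
      using absorb[of b c] that by simp
    also have "\<dots> = b \<rhd> (c \<rhd> b)"
      using neg_imp_exchange[of b c b] that by simp
    also have "c \<rhd> b = b \<rhd> c"
      using contrapos[of b c] that by simp
    also have "b \<rhd> (b \<rhd> c) = b \<rhd> c"
      using neg_imp_exchange[of b b c] imp_neg_self[of b] that by simp
    finally show ?thesis .
  qed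
  have "c \<rhd> b = b \<rhd> c"
    using contrapos[of b c] assms by simp
  then show ?thesis
    using *[of b c] *[of c b] assms by simp
qed

end

section \<open>Simple implication zroupoids\<close>

text \<open>The operation of \<open>A\<close> is composed with a retraction of the type onto the carrier. The result has
  values in the carrier and satisfies the defining identities for all elements of the type.\<close>

locale simple_izroupoid =
  fixes A :: "'a zalgebra"
  assumes izroupoid: "implication_zroupoid A"
    and simple: "simple_algebra A"
begin

definition retract :: "'a \<Rightarrow> 'a"
  where "retract x = (if x \<in> carrier A then x else \<zero>\<^bsub>A\<^esub>)"

definition total_imp :: "'a \<Rightarrow> 'a \<Rightarrow> 'a"  (infixr "\<rhd>" 65)
  where "x \<rhd> y = (retract x \<rightarrow>\<^bsub>A\<^esub> retract y)"

abbreviation bottom :: 'a  ("\<bottom>")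
  where "\<bottom> \<equiv> \<zero>\<^bsub>A\<^esub>"

abbreviation negation :: "'a \<Rightarrow> 'a"  ("\<sim> _" [80] 80)
  where "\<sim> x \<equiv> x \<rhd> \<bottom>"

abbreviation unit_elem :: 'a  ("\<top>")
  where "\<top> \<equiv> \<sim> \<bottom>"

lemma bottom_closed [simp]: "\<bottom> \<in> carrier A"
  using izroupoid by (simp add: implication_zroupoid_def is_algebra_def)

lemma retract_closed [simp]: "retract x \<in> carrier A"
  by (simp add: retract_def)

lemma retract_id [simp]: "x \<in> carrier A \<Longrightarrow> retract x = x"
  by (simp add: retract_def)

lemma total_imp_closed [simp]: "x \<rhd> y \<in> carrier A"
  using izroupoid by (simp add: implication_zroupoid_def is_algebra_def total_imp_def)

lemma imp_eq_total_imp: "x \<in> carrier A \<Longrightarrow> y \<in> carrier A \<Longrightarrow> (x \<rightarrow>\<^bsub>A\<^esub> y) = x \<rhd> y"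
  by (simp add: total_imp_def)

lemma total_imp_retract [simp]: "retract x \<rhd> y = x \<rhd> y" "x \<rhd> retract y = x \<rhd> y"
  by (simp_all add: total_imp_def)

sublocale zroupoid "(\<rhd>)" "\<bottom>"
proof
  fix x y z
  have closed: "(u \<rightarrow>\<^bsub>A\<^esub> v) \<in> carrier A" if "u \<in> carrier A" "v \<in> carrier A" for u v
    using izroupoid that by (simp add: implication_zroupoid_def is_algebra_def)
  have "(u \<rightarrow>\<^bsub>A\<^esub> v) \<rightarrow>\<^bsub>A\<^esub> w =
      zprime A ((zprime A w \<rightarrow>\<^bsub>A\<^esub> u) \<rightarrow>\<^bsub>A\<^esub> zprime A (v \<rightarrow>\<^bsub>A\<^esub> w))"
    if "u \<in> carrier A" "v \<in> carrier A" "w \<in> carrier A" for u v w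
    using izroupoid that unfolding implication_zroupoid_def by blast
  from this[of "retract x" "retract y" "retract z"]
  show "(x \<rhd> y) \<rhd> z = ((((z \<rhd> \<bottom>) \<rhd> x) \<rhd> ((y \<rhd> z) \<rhd> \<bottom>)) \<rhd> \<bottom>)"
    by (simp add: zprime_def total_imp_def closed)
  have "zprime A (zprime A \<bottom>) = \<bottom>"
    using izroupoid unfolding implication_zroupoid_def by blast
  then show "(\<bottom> \<rhd> \<bottom>) \<rhd> \<bottom> = \<bottom>"
    by (simp add: zprime_def total_imp_def closed)
qed

text \<open>Congruences of \<open>A\<close> enter the classification only as kernels of maps, in the form of this
  dichotomy; the map may take its values in any type, such as pairs or truth values.\<close>

lemma kernel_cases:
  assumes "\<And>x y z. \<lbrakk>x \<in> carrier A; y \<in> carrier A; z \<in> carrier A; f x = f y\<rbrakk>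
             \<Longrightarrow> f (x \<rhd> z) = f (y \<rhd> z) \<and> f (z \<rhd> x) = f (z \<rhd> y)"
  obtains "inj_on f (carrier A)" | "\<And>x y. \<lbrakk>x \<in> carrier A; y \<in> carrier A\<rbrakk> \<Longrightarrow> f x = f y"
proof -
  let ?K = "{(x, y). x \<in> carrier A \<and> y \<in> carrier A \<and> f x = f y}"
  have "equiv (carrier A) ?K"
    by (intro equivI refl_onI symI transI) auto
  moreover have "(x \<rightarrow>\<^bsub>A\<^esub> u, y \<rightarrow>\<^bsub>A\<^esub> v) \<in> ?K" if "(x, y) \<in> ?K" "(u, v) \<in> ?K" for x y u v
    using that assms[of x y u] assms[of u v y] by (simp add: imp_eq_total_imp)
  ultimately have "congruence A ?K"
    by (simp only: congruence_def) blast
  then consider "?K = Id_on (carrier A)" | "?K = carrier A \<times> carrier A"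
    using simple unfolding simple_algebra_def by blast
  then show thesis
  proof cases
    case 1
    have "inj_on f (carrier A)"
    proof (rule inj_onI)
      fix x y assume "x \<in> carrier A" "y \<in> carrier A" "f x = f y"
      then have "(x, y) \<in> ?K" by simp
      then show "x = y" by (simp only: 1 Id_on_iff)
    qed
    then show thesis by (rule that(1))
  next
    case 2
    have "f x = f y" if "x \<in> carrier A" "y \<in> carrier A" for x y
    proof -
      have "(x, y) \<in> ?K" using that by (simp only: 2 mem_Times_iff) simp
      then show ?thesis by simp
    qed
    then show thesis by (rule that(2))
  qed
qed

lemma ex_nonzero: obtains a where "a \<in> carrier A" "a \<noteq> \<bottom>"
  using simple unfolding simple_algebra_def by metis

text \<open>An enumeration of the carrier without repetitions that reproduces a multiplication table is an
  isomorphism. Comparing whole tables as lists lets the simplifier check all entries at once.\<close>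

lemma isomorphic_table:
  assumes xs: "distinct xs" "carrier A = set xs" "xs ! 0 = \<bottom>"
    and table: "map (\<lambda>x. map (\<lambda>y. x \<rhd> y) xs) xs = map (map ((!) xs)) tab"
    and entries: "\<And>row k. row \<in> set tab \<Longrightarrow> k \<in> set row \<Longrightarrow> k < length tab"
  shows "isomorphic A (table_algebra tab)"
proof -
  let ?I = "{..<length tab}" and ?h = "inv_into {..<length tab} ((!) xs)"
  have len: "length xs = length tab"
    using arg_cong[OF table, of length] by simp
  have bij: "bij_betw ((!) xs) ?I (carrier A)"
    by (rule bij_betw_nth) (simp_all add: xs len)
  have h: "?h (xs ! i) = i" if "i < length tab" for i
    using bij that by (simp add: bij_betw_def inv_into_f_f)
  have hom: "?h (xs ! i \<rhd> xs ! j) = tab ! i ! j" if i: "i < length tab" and j: "j < length tab" for i j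
  proof -
    have row: "map (\<lambda>y. xs ! i \<rhd> y) xs = map ((!) xs) (tab ! i)"
      using arg_cong[OF table, of "\<lambda>l. l ! i"] i len by simp
    then have "length (tab ! i) = length tab"
      using len by (metis length_map)
    then have "xs ! i \<rhd> xs ! j = xs ! (tab ! i ! j)" "tab ! i ! j < length tab"
      using arg_cong[OF row, of "\<lambda>l. l ! j"] entries[of "tab ! i" "tab ! i ! j"] i j len
      by simp_all
    then show ?thesis using h by simp
  qed
  show ?thesis
    unfolding isomorphic_def
  proof (intro exI[of _ ?h] conjI ballI)
    show "bij_betw ?h (carrier A) (carrier (table_algebra tab))"
      using bij_betw_inv_into[OF bij] by (simp add: table_algebra_def)
    fix x y assume xy: "x \<in> carrier A" "y \<in> carrier A"
    then obtain i j where "x = xs ! i" "y = xs ! j" "i < length tab" "j < length tab"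
      using xs(2) len by (metis in_set_conv_nth)
    then show "?h (x \<rightarrow>\<^bsub>A\<^esub> y) = ?h x \<rightarrow>\<^bsub>table_algebra tab\<^esub> ?h y"
      using xy by (simp add: imp_eq_total_imp hom h table_algebra_def)
  next
    have "tab \<noteq> []"
      using bottom_closed len xs(2) by auto
    then show "?h \<bottom> = \<zero>\<^bsub>table_algebra tab\<^esub>"
      using h[of 0] xs(3) by (simp add: table_algebra_def)
  qed
qed

lemma two_element_carrier:
  assumes "\<And>x y z. \<lbrakk>x \<in> carrier A; y \<in> carrier A; z \<in> carrier A; (x = \<bottom>) = (y = \<bottom>)\<rbrakk>
             \<Longrightarrow> (x \<rhd> z = \<bottom>) = (y \<rhd> z = \<bottom>) \<and> (z \<rhd> x = \<bottom>) = (z \<rhd> y = \<bottom>)"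
  obtains a where "a \<noteq> \<bottom>" "carrier A = {\<bottom>, a}"
proof (rule kernel_cases[of "\<lambda>x. x = \<bottom>"])
  obtain a where a: "a \<in> carrier A" "a \<noteq> \<bottom>"
    by (rule ex_nonzero)
  {
    assume inj: "inj_on (\<lambda>x. x = \<bottom>) (carrier A)"
    have "x = a" if "x \<in> carrier A" "x \<noteq> \<bottom>" for x
      using inj_onD[OF inj, of x a] that a by simp
    then show thesis
      using that[of a] a bottom_closed by blast
  next
    assume "\<And>x y. \<lbrakk>x \<in> carrier A; y \<in> carrier A\<rbrakk> \<Longrightarrow> (x = \<bottom>) = (y = \<bottom>)"
    then show thesis using a bottom_closed by blast
  }
qed (rule assms)

lemma trivial_case:
  assumes null: "\<And>x y. x \<rhd> y = \<bottom>"
  shows "isomorphic A two_z"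
proof -
  obtain a where a: "a \<noteq> \<bottom>" and carrier: "carrier A = {\<bottom>, a}"
    by (rule two_element_carrier) (simp_all add: null)
  show ?thesis
    unfolding two_z_def
    by (rule isomorphic_table[of "[\<bottom>, a]"]) (use a in \<open>auto simp: carrier null\<close>)
qed

text \<open>Every nested product is its own double negation, hence \<open>\<bottom>\<close> here; so products annihilate from
  the left, and identifying all products with \<open>\<bottom>\<close> is a congruence. If it is trivial, \<open>\<bottom>\<close> is the
  only product; if it is total, every element is a product. In both cases the operation is constant.\<close>

lemma collapse_case:
  assumes dneg: "\<And>x. \<sim> \<sim> x = \<bottom>"
  shows "isomorphic A two_z"
proof -
  have prod_imp: "(x \<rhd> y) \<rhd> z = \<bottom>" for x y z
    using neg_neg_imp_imp[of x y z] by (simp add: dneg)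
  then have "\<top> = \<bottom>"
    using prod_imp[of "\<bottom>" "\<bottom>" "\<bottom>"] neg_neg_bot top_imp dneg by metis
  then have bot_imp: "\<bottom> \<rhd> z = \<bottom>" for z
    using prod_imp[of "\<bottom>" "\<bottom>" z] by simp
  define P where "P = insert \<bottom> (range (case_prod (\<rhd>)))"
  have P: "x \<rhd> y \<in> P" for x y
    by (auto simp: P_def)
  have P_imp: "x \<rhd> z = \<bottom>" if "x \<in> P" for x z
    using that by (auto simp: P_def prod_imp bot_imp)
  let ?f = "\<lambda>x. if x \<in> P then \<bottom> else x"
  have bot_P: "\<bottom> \<in> P" by (simp add: P_def)
  have "x \<rhd> y = \<bottom>" for x y
  proof (rule kernel_cases[of ?f])
    fix u v z assume "?f u = ?f v"
    then have "u = v \<or> u \<in> P \<and> v \<in> P"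
      using bot_P by (auto split: if_splits)
    then show "?f (u \<rhd> z) = ?f (v \<rhd> z) \<and> ?f (z \<rhd> u) = ?f (z \<rhd> v)"
      by (simp add: P)
  next
    assume "inj_on ?f (carrier A)"
    then show ?thesis
      using P[of x y] bot_P by (auto dest!: inj_onD[of _ _ "x \<rhd> y" "\<bottom>"])
  next
    assume const: "\<And>x y. \<lbrakk>x \<in> carrier A; y \<in> carrier A\<rbrakk> \<Longrightarrow> ?f x = ?f y"
    have "retract x \<in> P"
      using const[of "retract x" "\<bottom>"] bot_P by (auto split: if_splits)
    then show ?thesis
      using P_imp[of "retract x" y] by simp
  qed
  then show ?thesis by (rule trivial_case)
qed

text \<open>Since \<open>x \<rhd> y\<close> is \<open>\<bottom>\<close> only for \<open>x = y = \<bottom>\<close>, mapping all nonzero elements to one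
  value is compatible with the operation.\<close>

lemma semilattice_case:
  assumes "involutive_zroupoid (\<rhd>) \<bottom>" and top: "\<top> = \<bottom>"
    and dneg: "\<And>x. x \<in> carrier A \<Longrightarrow> \<sim> \<sim> x = x"
  shows "isomorphic A two_s"
proof -
  interpret involutive_zroupoid "(\<rhd>)" "\<bottom>" by fact
  have eq_bot: "x \<rhd> y = \<bottom> \<longleftrightarrow> x = \<bottom> \<and> y = \<bottom>" if "x \<in> carrier A" "y \<in> carrier A" for x y
    using imp_eq_botD[OF top, of x y] that top by (auto simp: dneg)
  obtain a where a: "a \<noteq> \<bottom>" and carrier: "carrier A = {\<bottom>, a}"
    by (rule two_element_carrier) (simp_all add: eq_bot)
  have "x \<rhd> y = (if x = \<bottom> \<and> y = \<bottom> then \<bottom> else a)" if "x \<in> carrier A" "y \<in> carrier A" for x y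
    using eq_bot[OF that] total_imp_closed[of x y] by (auto simp: carrier)
  then show ?thesis
    unfolding two_s_def
    by (intro isomorphic_table[of "[\<bottom>, a]"]) (use a in \<open>auto simp: carrier\<close>)
qed

lemma de_morgan_case:
  assumes "de_morgan_zroupoid (\<rhd>) \<bottom>"
    and dneg: "\<And>x. x \<in> carrier A \<Longrightarrow> \<sim> \<sim> x = x"
  shows "isomorphic A two_b \<or> isomorphic A three_k \<or> isomorphic A four_d"
proof -
  interpret de_morgan_zroupoid "(\<rhd>)" "\<bottom>" by fact
  \<comment> \<open>As \<open>\<top>\<close> stands for \<open>\<bottom> \<rhd> \<bottom>\<close>, the rule \<open>\<bottom> \<rhd> x = \<top>\<close> would loop; an opaque name prevents this.\<close>
  define t where "t = \<top>"
  have t_closed: "t \<in> carrier A"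
    by (simp add: t_def)
  have bot_imp: "\<bottom> \<rhd> x = t" for x
    unfolding t_def by (rule bot_imp)
  have t_imp: "t \<rhd> x = x" if "x \<in> carrier A" for x
    using top_imp[of x] dneg[OF that] by (simp add: t_def)
  have imp_t: "x \<rhd> t = t" for x
    using imp_top[of x] bot_imp[of "\<sim> x"] by (simp add: t_def)
  have t_ne_bot: "t \<noteq> \<bottom>"
    using bot_imp t_imp ex_nonzero by metis
  have neg_eq: "\<sim> b = b \<rhd> b" if b: "b \<in> carrier A" "b \<noteq> t" for b
  proof (rule kernel_cases[of "\<lambda>x. (x \<rhd> b, \<sim> x \<rhd> b)"])
    fix x y z
    assume "(x \<rhd> b, \<sim> x \<rhd> b) = (y \<rhd> b, \<sim> y \<rhd> b)"
    then show "((x \<rhd> z) \<rhd> b, \<sim> (x \<rhd> z) \<rhd> b) = ((y \<rhd> z) \<rhd> b, \<sim> (y \<rhd> z) \<rhd> b) \<and>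
        ((z \<rhd> x) \<rhd> b, \<sim> (z \<rhd> x) \<rhd> b) = ((z \<rhd> y) \<rhd> b, \<sim> (z \<rhd> y) \<rhd> b)"
      using bounded_kernel_cong[of x b y z] by simp
  next
    assume "inj_on (\<lambda>x. (x \<rhd> b, \<sim> x \<rhd> b)) (carrier A)"
    then show ?thesis
      by (rule inj_onD) (simp_all only: bounded_kernel_neg total_imp_closed)
  next
    assume "\<And>x y. \<lbrakk>x \<in> carrier A; y \<in> carrier A\<rbrakk> \<Longrightarrow>
      (x \<rhd> b, \<sim> x \<rhd> b) = (y \<rhd> b, \<sim> y \<rhd> b)"
    then have "\<bottom> \<rhd> b = t \<rhd> b"
      using t_closed bottom_closed by blast
    then show ?thesis
      using b bot_imp[of b] t_imp[of b] by simp
  qed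
  define F where "F = carrier A - {\<bottom>, t}"
  have carrier: "carrier A = insert \<bottom> (insert t F)"
    using t_closed by (auto simp: F_def)
  have fixpoint: "\<sim> b = b" if "b \<in> F" for b
  proof -
    have b: "b \<in> carrier A" "b \<noteq> t" "b \<noteq> \<bottom>"
      using that by (auto simp: F_def)
    have "\<sim> b \<noteq> t"
      using dneg[of b] b by (auto simp: t_def)
    then have "\<sim> \<sim> b = \<sim> b \<rhd> \<sim> b"
      using neg_eq[of "\<sim> b"] by simp
    also have "\<dots> = b \<rhd> b"
      by (rule contrapos[symmetric])
    also have "\<dots> = \<sim> b"
      using neg_eq b by simp
    finally show ?thesis
      using dneg b by simp
  qed
  have idem: "b \<rhd> b = b" if "b \<in> F" for b
    using neg_eq[of b] fixpoint[of b] that by (auto simp: F_def)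
  have imp_eq_t: "b \<rhd> c = t" if "b \<in> F" "c \<in> F" "b \<noteq> c" for b c
  proof -
    have "b \<rhd> c \<notin> F"
      using fixpoint_imp_eqD[of b c] fixpoint that by blast
    moreover have "b \<rhd> c \<noteq> \<bottom>"
      using absorb[of b c] bot_imp[of b] fixpoint[of b] that by (auto simp: F_def)
    ultimately show ?thesis
      by (auto simp: F_def)
  qed
  \<comment> \<open>Both \<open>c\<close> and \<open>e\<close> are complements of \<open>b\<close>, and \<open>c \<rhd> e = t\<close>; distributivity then yields \<open>b = t\<close>.\<close>
  have no_three: False if "b \<in> F" "c \<in> F" "e \<in> F" "b \<noteq> c" "b \<noteq> e" "c \<noteq> e" for b c e
  proof -
    have "(c \<rhd> e) \<rhd> b = \<sim> ((\<sim> b \<rhd> c) \<rhd> \<sim> (e \<rhd> b))"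
      by (rule imp_imp)
    then have "b = t"
      using that imp_eq_t[of c e] imp_eq_t[of b c] imp_eq_t[of e b] fixpoint[of b] t_imp[of b]
        t_imp[of "\<bottom>"] t_imp[of "\<sim> t"]
      by (auto simp: F_def bot_imp dneg)
    then show False using that by (simp add: F_def)
  qed
  consider "F = {}" | b where "F = {b}" | b c where "F = {b, c}" "b \<noteq> c"
    using no_three by blast
  then show ?thesis
  proof cases
    case 1
    have "isomorphic A two_b"
      unfolding two_b_def
      by (rule isomorphic_table[of "[\<bottom>, t]"])
        (use t_ne_bot 1 in \<open>auto simp: carrier bot_imp t_imp imp_t\<close>)
    then show ?thesis by simp
  next
    case (2 b)
    then have b: "b \<noteq> \<bottom>" "b \<noteq> t"
      by (auto simp: F_def)
    have "b \<rhd> \<bottom> = b" "b \<rhd> b = b"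
      using 2 fixpoint[of b] idem[of b] by simp_all
    then have "isomorphic A three_k"
      unfolding three_k_def
      by (intro isomorphic_table[of "[\<bottom>, t, b]"])
        (use t_ne_bot 2 b in \<open>auto simp: carrier bot_imp t_imp imp_t\<close>)
    then show ?thesis by simp
  next
    case (3 b c)
    then have b: "b \<noteq> \<bottom>" "b \<noteq> t" "c \<noteq> \<bottom>" "c \<noteq> t"
      by (auto simp: F_def)
    have "b \<rhd> \<bottom> = b" "b \<rhd> b = b" "c \<rhd> \<bottom> = c" "c \<rhd> c = c" "b \<rhd> c = t" "c \<rhd> b = t"
      using 3 fixpoint[of b] fixpoint[of c] idem[of b] idem[of c] imp_eq_t[of b c] imp_eq_t[of c b]
      by simp_all
    then have "isomorphic A four_d"
      unfolding four_d_def
      by (intro isomorphic_table[of "[\<bottom>, t, b, c]"])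
        (use t_ne_bot 3 b in \<open>auto simp: carrier bot_imp t_imp imp_t\<close>)
    then show ?thesis by simp
  qed
qed

lemma classification:
  "\<exists>B \<in> {two_z, two_s, two_b, three_k, four_d}. isomorphic A B"
proof (rule kernel_cases[of "\<lambda>x. \<sim> \<sim> x"])
  fix x y z assume "\<sim> \<sim> x = \<sim> \<sim> y"
  then show "\<sim> \<sim> (x \<rhd> z) = \<sim> \<sim> (y \<rhd> z) \<and> \<sim> \<sim> (z \<rhd> x) = \<sim> \<sim> (z \<rhd> y)"
    by (simp add: neg_neg_imp)
next
  assume const: "\<And>x y. \<lbrakk>x \<in> carrier A; y \<in> carrier A\<rbrakk> \<Longrightarrow> \<sim> \<sim> x = \<sim> \<sim> y"
  have "\<sim> \<sim> x = \<bottom>" for x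
    using const[of "retract x" "\<bottom>"] neg_neg_bot by simp
  then have "isomorphic A two_z" by (rule collapse_case)
  then show ?thesis by simp
next
  assume inj: "inj_on (\<lambda>x. \<sim> \<sim> x) (carrier A)"
  have dneg: "\<sim> \<sim> x = x" if "x \<in> carrier A" for x
    using inj_onD[OF inj, of "\<sim> \<sim> x" x] neg4 that by simp
  have dneg_retract: "\<sim> \<sim> x = retract x" for x
    using dneg[of "retract x"] by simp
  interpret involutive_zroupoid "(\<rhd>)" "\<bottom>"
    by unfold_locales (simp_all add: dneg_retract)
  show ?thesis
  proof (rule kernel_cases[of "\<lambda>x. \<bottom> \<rhd> x"])
    fix x y z assume "\<bottom> \<rhd> x = \<bottom> \<rhd> y"
    then show "\<bottom> \<rhd> (x \<rhd> z) = \<bottom> \<rhd> (y \<rhd> z) \<and> \<bottom> \<rhd> (z \<rhd> x) = \<bottom> \<rhd> (z \<rhd> y)"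
      using bot_imp_imp_cong by blast
  next
    assume "inj_on (\<lambda>x. \<bottom> \<rhd> x) (carrier A)"
    then have "\<bottom> \<rhd> \<bottom> = \<bottom>"
      by (rule inj_onD) (simp_all add: bot_imp_bot_imp)
    then have "isomorphic A two_s"
      using involutive_zroupoid_axioms dneg by (intro semilattice_case)
    then show ?thesis by simp
  next
    assume const: "\<And>x y. \<lbrakk>x \<in> carrier A; y \<in> carrier A\<rbrakk> \<Longrightarrow> \<bottom> \<rhd> x = \<bottom> \<rhd> y"
    have "\<bottom> \<rhd> x = \<top>" for x
      using const[of "retract x" "\<bottom>"] by simp
    then have "de_morgan_zroupoid (\<rhd>) \<bottom>"
      by unfold_locales
    then have "isomorphic A two_b \<or> isomorphic A three_k \<or> isomorphic A four_d"
      using dneg by (rule de_morgan_case)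
    then show ?thesis by auto
  qed
qed

end


section \<open>The five algebras\<close>

lemmas table_simps = implication_zroupoid_def is_algebra_def zprime_def table_algebra_def
  two_z_def two_s_def two_b_def three_k_def four_d_def lessThan_Suc numeral_2_eq_2 numeral_3_eq_3

lemma izroupoids:
  "implication_zroupoid two_z" "implication_zroupoid two_s" "implication_zroupoid two_b"
  "implication_zroupoid three_k" "implication_zroupoid four_d"
  by (simp_all add: table_simps)

lemma congruence_imp_left:
  assumes "congruence A \<theta>" and "(x, y) \<in> \<theta>" and "z \<in> carrier A"
  shows "(x \<rightarrow>\<^bsub>A\<^esub> z, y \<rightarrow>\<^bsub>A\<^esub> z) \<in> \<theta>"
proof -
  have "(z, z) \<in> \<theta>"
    using assms unfolding congruence_def equiv_def refl_on_def by blast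
  then show ?thesis
    using assms unfolding congruence_def by blast
qed

lemma congruence_sym: "congruence A \<theta> \<Longrightarrow> (x, y) \<in> \<theta> \<Longrightarrow> (y, x) \<in> \<theta>"
  unfolding congruence_def equiv_def sym_def by blast

lemma congruence_trans: "congruence A \<theta> \<Longrightarrow> (x, y) \<in> \<theta> \<Longrightarrow> (y, z) \<in> \<theta> \<Longrightarrow> (x, z) \<in> \<theta>"
  unfolding congruence_def equiv_def trans_def by blast

lemma simple_algebraI:
  assumes nontrivial: "\<exists>x\<in>carrier A. \<exists>y\<in>carrier A. x \<noteq> y"
    and collapse: "\<And>\<theta> x y z. \<lbrakk>congruence A \<theta>; (x, y) \<in> \<theta>; x \<in> carrier A; y \<in> carrier A; x \<noteq> y;
      z \<in> carrier A\<rbrakk> \<Longrightarrow> (\<zero>\<^bsub>A\<^esub>, z) \<in> \<theta>"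
  shows "simple_algebra A"
  unfolding simple_algebra_def
proof (intro conjI allI impI nontrivial)
  fix \<theta> assume \<theta>: "congruence A \<theta>"
  then have sub: "\<theta> \<subseteq> carrier A \<times> carrier A" and refl: "\<And>x. x \<in> carrier A \<Longrightarrow> (x, x) \<in> \<theta>"
    unfolding congruence_def equiv_def refl_on_def by blast+
  show "\<theta> = Id_on (carrier A) \<or> \<theta> = carrier A \<times> carrier A"
  proof (cases "\<exists>x y. x \<noteq> y \<and> (x, y) \<in> \<theta>")
    case True
    then have "(\<zero>\<^bsub>A\<^esub>, z) \<in> \<theta>" if "z \<in> carrier A" for z
      using collapse[OF \<theta>] that sub by blast
    then have "(x, y) \<in> \<theta>" if "x \<in> carrier A" "y \<in> carrier A" for x y
      using that congruence_sym[OF \<theta>] congruence_trans[OF \<theta>] by blast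
    then show ?thesis using sub by auto
  next
    case False
    then have "\<theta> = Id_on (carrier A)"
      using sub refl by (auto simp: Id_on_def)
    then show ?thesis ..
  qed
qed

lemma simple_two_element:
  assumes "carrier A = {0, 1::nat}" and "\<zero>\<^bsub>A\<^esub> = 0"
  shows "simple_algebra A"
proof (rule simple_algebraI)
  show "\<exists>x\<in>carrier A. \<exists>y\<in>carrier A. x \<noteq> y"
    using assms by simp
  fix \<theta> x y z
  assume \<theta>: "congruence A \<theta>" and "(x, y) \<in> \<theta>" "x \<in> carrier A" "y \<in> carrier A" "x \<noteq> y"
    "z \<in> carrier A"
  moreover have "(0, 0) \<in> \<theta>"
    using \<theta> assms unfolding congruence_def equiv_def refl_on_def by simp
  ultimately show "(\<zero>\<^bsub>A\<^esub>, z) \<in> \<theta>"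
    using assms congruence_sym[OF \<theta>] by auto
qed

text \<open>The hypotheses describe the tables of \<open>two_b\<close>, \<open>three_k\<close> and \<open>four_d\<close> as found in the
  classification: the elements other than \<open>0\<close> and \<open>1\<close> are fixed points of the negation, and two
  distinct ones join to \<open>1\<close>. Multiplying a pair of distinct related elements by \<open>0\<close> or by one of
  the two on the right relates \<open>0\<close> to \<open>1\<close>, and multiplying \<open>0\<close> and \<open>1\<close> by \<open>z\<close> on the right then relates
  \<open>1\<close> to \<open>z\<close>.\<close>

lemma simple_fixpoints:
  assumes zero: "\<zero>\<^bsub>A\<^esub> = 0" "0 \<in> carrier A" and one: "(1::nat) \<in> carrier A"
    and zero_imp: "\<And>z. z \<in> carrier A \<Longrightarrow> (0 \<rightarrow>\<^bsub>A\<^esub> z) = 1"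
    and one_imp: "\<And>z. z \<in> carrier A \<Longrightarrow> (1 \<rightarrow>\<^bsub>A\<^esub> z) = z"
    and fixpoint: "\<And>b. b \<in> carrier A - {0, 1} \<Longrightarrow> (b \<rightarrow>\<^bsub>A\<^esub> 0) = b \<and> (b \<rightarrow>\<^bsub>A\<^esub> b) = b"
    and imp_one: "\<And>b c. \<lbrakk>b \<in> carrier A - {0, 1}; c \<in> carrier A - {0, 1}; b \<noteq> c\<rbrakk> \<Longrightarrow> (c \<rightarrow>\<^bsub>A\<^esub> b) = 1"
  shows "simple_algebra A"
proof (rule simple_algebraI)
  show "\<exists>x\<in>carrier A. \<exists>y\<in>carrier A. x \<noteq> y"
    using zero one zero_neq_one by blast
  fix \<theta> x y z
  assume \<theta>: "congruence A \<theta>" and xy: "(x, y) \<in> \<theta>" "x \<in> carrier A" "y \<in> carrier A" "x \<noteq> y"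
    and z: "z \<in> carrier A"
  note sym = congruence_sym[OF \<theta>] and trans = congruence_trans[OF \<theta>]
    and left = congruence_imp_left[OF \<theta>]
  have zero_fix: "(0, 1) \<in> \<theta>" if "(0, b) \<in> \<theta>" "b \<in> carrier A - {0, 1}" for b
    using left[OF that(1) zero(2)] fixpoint[OF that(2)] zero_imp[OF zero(2)] that(1) sym trans
    by metis
  have one_fix: "(0, 1) \<in> \<theta>" if "(1, b) \<in> \<theta>" "b \<in> carrier A - {0, 1}" for b
    using left[OF that(1) zero(2)] fixpoint[OF that(2)] one_imp[OF zero(2)] zero_fix that(2)
    by metis
  have fix_fix: "(0, 1) \<in> \<theta>"
    if "(b, c) \<in> \<theta>" "b \<in> carrier A - {0, 1}" "c \<in> carrier A - {0, 1}" "b \<noteq> c" for b c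
    using left[OF that(1), of b] fixpoint[OF that(2)] imp_one[OF that(2-4)] one_fix[of b] sym that(2)
    by simp
  have "(0, 1) \<in> \<theta>"
  proof (cases "x \<in> {0, 1}")
    case True
    then show ?thesis
      using xy zero_fix[of y] one_fix[of y] sym by (cases "y \<in> {0, 1}") auto
  next
    case False
    then show ?thesis
      using xy zero_fix[of x] one_fix[of x] fix_fix[of x y] sym by (cases "y \<in> {0, 1}") auto
  qed
  moreover from left[OF this z] have "(1, z) \<in> \<theta>"
    by (simp only: zero_imp[OF z] one_imp[OF z])
  ultimately show "(\<zero>\<^bsub>A\<^esub>, z) \<in> \<theta>"
    using trans zero(1) by simp
qed

lemma simple_algebras:
  "simple_algebra two_z" "simple_algebra two_s" "simple_algebra two_b"
  "simple_algebra three_k" "simple_algebra four_d"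
proof -
  show "simple_algebra two_z" "simple_algebra two_s"
    by (rule simple_two_element; auto simp: table_simps)+
  show "simple_algebra two_b" "simple_algebra three_k" "simple_algebra four_d"
    by (rule simple_fixpoints; auto simp: table_simps)+
qed


section \<open>The classification\<close>

theorem theorem5p8:
  shows "(\<forall>B \<in> {two_z, two_s, two_b, three_k, four_d}.
            implication_zroupoid B \<and> simple_algebra B) \<and>
         (\<forall>A :: 'a zalgebra. implication_zroupoid A \<and> simple_algebra A \<longrightarrow>
            (\<exists>B \<in> {two_z, two_s, two_b, three_k, four_d}. isomorphic A B))"
proof (intro conjI allI impI)
  show "\<forall>B \<in> {two_z, two_s, two_b, three_k, four_d}. implication_zroupoid B \<and> simple_algebra B"
    by (simp add: izroupoids simple_algebras)
  fix A :: "'a zalgebra"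
  assume "implication_zroupoid A \<and> simple_algebra A"
  then interpret simple_izroupoid A
    by unfold_locales simp_all
  show "\<exists>B \<in> {two_z, two_s, two_b, three_k, four_d}. isomorphic A B"
    by (rule classification)
qed

end
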